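(* Let $A\in\{0,1\}$ be a treatment, $Y(1),Y(0)$ real-valued potential outcomes, $Y=AY(1)+(1-A)Y(0)$, $Z$ a general (possibly vector-valued) pretreatment variable, $\Pi=\mathrm{pr}(A=1\mid Z)$ and $\nu_a(\pi)=E(Y\mid A=a,\Pi=\pi)$. No causal diagram is assumed. If for both $a=1$ and $a=0$, $\mathrm{pr}\{A=1\mid Y(a)\}$ is non-decreasing in $Y(a)$ and $\mathrm{cov}\{\Pi,\nu_a(\Pi)\}\le 0$, then $$\mathrm{ACE}_1^{\mathrm{adj}}\ge \mathrm{ACE}^{\mathrm{unadj}}\ge \mathrm{ACE}_1^{\mathrm{true}},\qquad \mathrm{ACE}_0^{\mathrm{adj}}\ge \mathrm{ACE}^{\mathrm{unadj}}\ge \mathrm{ACE}_0^{\mathrm{true}},\qquad \mathrm{ACE}^{\mathrm{adj}}\ge \mathrm{ACE}^{\mathrm{unadj}}\ge \mathrm{ACE}^{\mathrm{true}}.$$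
   Context: True average causal effects: $\mathrm{ACE}_1^{\mathrm{true}}=E\{Y(1)\mid A=1\}-E\{Y(0)\mid A=1\}$, $\mathrm{ACE}_0^{\mathrm{true}}=E\{Y(1)\mid A=0\}-E\{Y(0)\mid A=0\}$, $\mathrm{ACE}^{\mathrm{true}}=E\{Y(1)\}-E\{Y(0)\}$. Unadjusted estimator: $\mathrm{ACE}^{\mathrm{unadj}}=E(Y\mid A=1)-E(Y\mid A=0)$. Adjusted estimators, with $F$ denoting distributions of $\Pi$: $\mathrm{ACE}_1^{\mathrm{adj}}=E(Y\mid A=1)-\int\nu_0(\pi)\,F(d\pi\mid A=1)$, $\mathrm{ACE}_0^{\mathrm{adj}}=\int\nu_1(\pi)\,F(d\pi\mid A=0)-E(Y\mid A=0)$, $\mathrm{ACE}^{\mathrm{adj}}=\int\nu_1(\pi)\,F(d\pi)-\int\nu_0(\pi)\,F(d\pi)$. Conventions: everything is conditional on observed covariates, which are suppressed. All expectations and covariances appearing are assumed to exist and be finite, and all conditional quantities are assumed well defined (in particular $0<\Pi<1$ almost surely); monotonicity of a conditional probability in a conditioning value means that it has a version with that monotonicity. *)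

theory Defs
  imports "HOL-Probability.Probability"
begin

text \<open>
  A version of the regression of \<open>f\<close> on \<open>X\<close>: a measurable function \<open>h\<close> on the range space of \<open>X\<close>
  such that \<open>h(X)\<close> is a version of the conditional expectation of \<open>f\<close> given the
  \<open>\<sigma>\<close>-algebra generated by \<open>X\<close>, that is, \<open>h(x) = E(f | X = x)\<close>.
\<close>

definition regression_version ::
  "'w measure \<Rightarrow> ('w \<Rightarrow> real) \<Rightarrow> ('w \<Rightarrow> 'x) \<Rightarrow> 'x measure \<Rightarrow> ('x \<Rightarrow> real) \<Rightarrow> bool" where
  "regression_version P f X N h \<longleftrightarrow>
     h \<in> borel_measurable N \<and>
     (AE w in P. h (X w) = real_cond_exp P (vimage_algebra (space P) X N) f w)"

definition covar :: "'w measure \<Rightarrow> ('w \<Rightarrow> real) \<Rightarrow> ('w \<Rightarrow> real) \<Rightarrow> real" where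
  "covar P U V = (\<integral>w. (U w - (\<integral>x. U x \<partial>P)) * (V w - (\<integral>x. V x \<partial>P)) \<partial>P)"

definition arm :: "'w measure \<Rightarrow> ('w \<Rightarrow> nat) \<Rightarrow> nat \<Rightarrow> 'w set" where
  "arm P A a = {w \<in> space P. A w = a}"

definition given_arm :: "'w measure \<Rightarrow> ('w \<Rightarrow> nat) \<Rightarrow> nat \<Rightarrow> 'w measure" where
  "given_arm P A a = uniform_measure P (arm P A a)"

definition observed :: "('w \<Rightarrow> nat) \<Rightarrow> (nat \<Rightarrow> 'w \<Rightarrow> real) \<Rightarrow> 'w \<Rightarrow> real" where
  "observed A Y w = real (A w) * Y 1 w + (1 - real (A w)) * Y 0 w"

definition ACE_true :: "'w measure \<Rightarrow> (nat \<Rightarrow> 'w \<Rightarrow> real) \<Rightarrow> real" where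
  "ACE_true P Y = (\<integral>w. Y 1 w \<partial>P) - (\<integral>w. Y 0 w \<partial>P)"

definition ACE_true_arm ::
  "'w measure \<Rightarrow> ('w \<Rightarrow> nat) \<Rightarrow> (nat \<Rightarrow> 'w \<Rightarrow> real) \<Rightarrow> nat \<Rightarrow> real" where
  "ACE_true_arm P A Y a =
     (\<integral>w. Y 1 w \<partial>given_arm P A a) - (\<integral>w. Y 0 w \<partial>given_arm P A a)"

definition ACE_unadj :: "'w measure \<Rightarrow> ('w \<Rightarrow> nat) \<Rightarrow> (nat \<Rightarrow> 'w \<Rightarrow> real) \<Rightarrow> real" where
  "ACE_unadj P A Y =
     (\<integral>w. observed A Y w \<partial>given_arm P A 1) - (\<integral>w. observed A Y w \<partial>given_arm P A 0)"

text \<open>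
  In the adjusted estimators, \<open>ps\<close> is the propensity score \<open>pr(A = 1 | Z)\<close> as a random variable, and
  \<open>\<nu> a p = E(Y | A = a, ps = p)\<close> is a regression of the observed outcome on \<open>ps\<close> under
  \<open>given_arm P A a\<close>. If \<open>0 < ps < 1\<close> almost surely, \<open>\<nu> a\<close> is unique up to a null set of the
  law of \<open>ps\<close> under \<open>P\<close>, so its integrals against all the laws below do not depend on the version.
\<close>

definition ACE1_adj ::
  "'w measure \<Rightarrow> ('w \<Rightarrow> nat) \<Rightarrow> (nat \<Rightarrow> 'w \<Rightarrow> real) \<Rightarrow> ('w \<Rightarrow> real) \<Rightarrow> (nat \<Rightarrow> real \<Rightarrow> real) \<Rightarrow> real" where
  "ACE1_adj P A Y ps \<nu> =
     (\<integral>w. observed A Y w \<partial>given_arm P A 1) - (\<integral>p. \<nu> 0 p \<partial>distr (given_arm P A 1) borel ps)"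

definition ACE0_adj ::
  "'w measure \<Rightarrow> ('w \<Rightarrow> nat) \<Rightarrow> (nat \<Rightarrow> 'w \<Rightarrow> real) \<Rightarrow> ('w \<Rightarrow> real) \<Rightarrow> (nat \<Rightarrow> real \<Rightarrow> real) \<Rightarrow> real" where
  "ACE0_adj P A Y ps \<nu> =
     (\<integral>p. \<nu> 1 p \<partial>distr (given_arm P A 0) borel ps) - (\<integral>w. observed A Y w \<partial>given_arm P A 0)"

definition ACE_adj :: "'w measure \<Rightarrow> ('w \<Rightarrow> real) \<Rightarrow> (nat \<Rightarrow> real \<Rightarrow> real) \<Rightarrow> real" where
  "ACE_adj P ps \<nu> =
     (\<integral>p. \<nu> 1 p \<partial>distr P borel ps) - (\<integral>p. \<nu> 0 p \<partial>distr P borel ps)"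

end

theory Submission
  imports Defs
begin

text \<open>
  Two covariance inequalities carry the proof. Monotonicity of \<open>pr(A = 1 | Y(a))\<close> in \<open>Y(a)\<close> makes
  \<open>Y(a)\<close> and \<open>A\<close> non-negatively correlated, so \<open>E(Y(a) | A = 1) \<ge> E(Y(a)) \<ge> E(Y(a) | A = 0)\<close>.
  The balancing property \<open>E(1{A = 1} \<phi>(\<Pi>)) = E(\<Pi> \<phi>(\<Pi>))\<close> turns the hypothesis
  \<open>cov(\<Pi>, \<nu>\<^sub>a(\<Pi>)) \<le> 0\<close> into
  \<open>E(\<nu>\<^sub>a(\<Pi>) | A = 1) \<le> E(\<nu>\<^sub>a(\<Pi>)) \<le> E(\<nu>\<^sub>a(\<Pi>) | A = 0)\<close>, and \<open>E(\<nu>\<^sub>a(\<Pi>) | A = a) = E(Y | A = a)\<close>.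
\<close>

text \<open>Any \<phi>(X) is measurable for the \<sigma>-algebra generated by X, so it can be pulled
  out of the conditional expectation of f; h(X) agrees with that conditional expectation almost
  everywhere. Every regression hypothesis below is used only through this identity, by choosing the
  test function \<phi>.\<close>

lemma regression_version_integral:
  assumes "prob_space P" and X: "X \<in> P \<rightarrow>\<^sub>M N" and reg: "regression_version P f X N h"
    and f: "f \<in> borel_measurable P" and \<phi>: "\<phi> \<in> borel_measurable N"
    and int: "integrable P (\<lambda>w. \<phi> (X w) * f w)"
  shows "integrable P (\<lambda>w. \<phi> (X w) * h (X w))"
    and "(\<integral>w. \<phi> (X w) * h (X w) \<partial>P) = (\<integral>w. \<phi> (X w) * f w \<partial>P)"
proof -
  interpret prob_space P by fact
  let ?F = "vimage_algebra (space P) X N"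
  have sub: "subalgebra P ?F"
    using X by (auto simp: subalgebra_def measurable_iff_sets sets_image_in_sets)
  interpret finite_measure_subalgebra P ?F
    by unfold_locales (rule sub)
  have "X \<in> ?F \<rightarrow>\<^sub>M N"
    using X by (intro measurable_vimage_algebra1) (auto dest: measurable_space)
  then have \<phi>X: "(\<lambda>w. \<phi> (X w)) \<in> borel_measurable ?F"
    using \<phi> by measurable
  have h: "(\<lambda>w. h (X w)) \<in> borel_measurable P"
    using reg X by (auto simp: regression_version_def)
  have \<phi>P: "(\<lambda>w. \<phi> (X w)) \<in> borel_measurable P"
    using X \<phi> by measurable
  have ae: "AE w in P. \<phi> (X w) * h (X w) = \<phi> (X w) * real_cond_exp P ?F f w"
    using reg by (auto simp: regression_version_def)
  have "integrable P (\<lambda>w. \<phi> (X w) * real_cond_exp P ?F f w)"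
    and eq: "(\<integral>w. \<phi> (X w) * real_cond_exp P ?F f w \<partial>P) = (\<integral>w. \<phi> (X w) * f w \<partial>P)"
    using real_cond_exp_intg[OF int \<phi>X f] by auto
  then show "integrable P (\<lambda>w. \<phi> (X w) * h (X w))"
    using integrable_cong_AE[OF _ _ ae] h \<phi>P by (simp add: borel_measurable_integrable)
  show "(\<integral>w. \<phi> (X w) * h (X w) \<partial>P) = (\<integral>w. \<phi> (X w) * f w \<partial>P)"
    unfolding eq[symmetric] using h \<phi>P by (intro integral_cong_AE ae) auto
qed

lemma
  fixes f :: "'w \<Rightarrow> real"
  assumes "prob_space P" and B: "B \<in> sets P" and pos: "measure P B > 0"
    and f: "f \<in> borel_measurable P"
  shows integral_uniform_measure_eq:
      "(\<integral>w. f w \<partial>uniform_measure P B) = (\<integral>w. indicator B w * f w \<partial>P) / measure P B"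
    and integrable_uniform_measure_iff:
      "integrable (uniform_measure P B) f \<longleftrightarrow> integrable P (\<lambda>w. indicator B w * f w)"
proof -
  interpret prob_space P by fact
  \<comment> \<open>The density is rewritten from an \<open>ennreal\<close> quotient into the image
    of a non-negative real function, the form in which Bochner integrals against a density can be
    evaluated. Positivity of \<open>measure P B\<close> makes the two quotients agree.\<close>
  have dens: "uniform_measure P B = density P (\<lambda>w. ennreal (indicator B w / measure P B))"
    unfolding uniform_measure_def
    by (intro density_cong)
      (use B pos in \<open>auto simp: emeasure_eq_measure divide_ennreal simp flip: ennreal_1 split: split_indicator\<close>)
  show "(\<integral>w. f w \<partial>uniform_measure P B) = (\<integral>w. indicator B w * f w \<partial>P) / measure P B"
    unfolding dens using B f pos by (subst integral_density) auto
  show "integrable (uniform_measure P B) f \<longleftrightarrow> integrable P (\<lambda>w. indicator B w * f w)"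
    unfolding dens using B f pos by (subst integrable_density) (auto simp: divide_inverse mult.commute[of _ "inverse _"] mult.assoc)
qed

lemma covar_eq:
  assumes "prob_space P" "integrable P U" "integrable P V" "integrable P (\<lambda>w. U w * V w)"
  shows "covar P U V = (\<integral>w. U w * V w \<partial>P) - (\<integral>w. U w \<partial>P) * (\<integral>w. V w \<partial>P)"
proof -
  interpret prob_space P by fact
  have "covar P U V = (\<integral>w. U w * V w - (\<integral>x. U x \<partial>P) * V w - (\<integral>x. V x \<partial>P) * U w
      + (\<integral>x. U x \<partial>P) * (\<integral>x. V x \<partial>P) \<partial>P)"
    unfolding covar_def by (simp add: algebra_simps)
  also have "\<dots> = (\<integral>w. U w * V w \<partial>P) - (\<integral>w. U w \<partial>P) * (\<integral>w. V w \<partial>P)"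
    using assms by (simp add: prob_space)
  finally show ?thesis .
qed

lemma mono_regression_imp_nonneg_corr:
  fixes X f :: "'w \<Rightarrow> real"
  assumes "prob_space P" and X: "integrable P X" and "mono g"
    and reg: "regression_version P f X borel g"
    and f: "integrable P f" and Xf: "integrable P (\<lambda>w. X w * f w)"
  shows "(\<integral>w. X w \<partial>P) * (\<integral>w. f w \<partial>P) \<le> (\<integral>w. X w * f w \<partial>P)"
proof -
  interpret prob_space P by fact
  define m where "m = (\<integral>w. X w \<partial>P)"
  note v = regression_version_integral[OF assms(1) borel_measurable_integrable[OF X] reg
      borel_measurable_integrable[OF f]]
  \<comment> \<open>Testing with \<phi>(x) = x here and with \<phi> = 1 below lets g(X) replace f in
    both integrals, so only the association between X and a monotone function of X is left to
    study.\<close>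
  have Xg: "integrable P (\<lambda>w. X w * g (X w))" "(\<integral>w. X w * g (X w) \<partial>P) = (\<integral>w. X w * f w \<partial>P)"
    using v[of "\<lambda>x. x"] Xf by auto
  have g: "integrable P (\<lambda>w. g (X w))" "(\<integral>w. g (X w) \<partial>P) = (\<integral>w. f w \<partial>P)"
    using v[of "\<lambda>_. 1"] f by auto
  \<comment> \<open>Chebyshev's association inequality: centring \<open>g\<close> at \<open>g m\<close> rather than at its mean
    makes the integrand non-negative pointwise and costs nothing since \<open>E(X - m) = 0\<close>.\<close>
  have "0 \<le> (X w - m) * (g (X w) - g m)" for w
    using monoD[OF \<open>mono g\<close>, of "X w" m] monoD[OF \<open>mono g\<close>, of m "X w"]
    by (cases "X w \<le> m") (auto intro: mult_nonpos_nonpos mult_nonneg_nonneg)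
  then have "0 \<le> (\<integral>w. (X w - m) * (g (X w) - g m) \<partial>P)"
    by (rule integral_nonneg_AE[OF AE_I2])
  also have "\<dots> = (\<integral>w. X w * g (X w) - m * g (X w) - g m * X w + m * g m \<partial>P)"
    by (simp add: algebra_simps)
  also have "\<dots> = (\<integral>w. X w * f w \<partial>P) - m * (\<integral>w. f w \<partial>P)"
    using Xg g X by (simp add: prob_space m_def)
  finally show ?thesis by (simp add: m_def)
qed

theorem theorem4:
  fixes P :: "'w measure" and A :: "'w \<Rightarrow> nat" and Y :: "nat \<Rightarrow> 'w \<Rightarrow> real"
    and Z :: "'w \<Rightarrow> 'z" and N :: "'z measure"
    and e :: "'z \<Rightarrow> real" and ps :: "'w \<Rightarrow> real" and \<nu> :: "nat \<Rightarrow> real \<Rightarrow> real"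
  assumes "prob_space P"
    and "A \<in> P \<rightarrow>\<^sub>M count_space UNIV"
    and "\<And>w. w \<in> space P \<Longrightarrow> A w \<in> {0, 1}"
    and "\<And>a. a \<in> {0, 1} \<Longrightarrow> integrable P (Y a)"
    and "Z \<in> P \<rightarrow>\<^sub>M N"
    and "regression_version P (indicator (arm P A 1)) Z N e"
    and "ps = (\<lambda>w. e (Z w))"
    and "AE w in P. 0 < ps w \<and> ps w < 1"
    and "\<And>a. a \<in> {0, 1} \<Longrightarrow>
           regression_version (given_arm P A a) (observed A Y) ps borel (\<nu> a)"
    and "\<And>a. a \<in> {0, 1} \<Longrightarrow> integrable P (\<lambda>w. \<nu> a (ps w))"
    and "\<And>a. a \<in> {0, 1} \<Longrightarrow>
           \<exists>g. mono g \<and> regression_version P (indicator (arm P A 1)) (Y a) borel g"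
    and "\<And>a. a \<in> {0, 1} \<Longrightarrow> covar P ps (\<lambda>w. \<nu> a (ps w)) \<le> 0"
  shows "(ACE1_adj P A Y ps \<nu> \<ge> ACE_unadj P A Y \<and> ACE_unadj P A Y \<ge> ACE_true_arm P A Y 1) \<and>
         (ACE0_adj P A Y ps \<nu> \<ge> ACE_unadj P A Y \<and> ACE_unadj P A Y \<ge> ACE_true_arm P A Y 0) \<and>
         (ACE_adj P ps \<nu> \<ge> ACE_unadj P A Y \<and> ACE_unadj P A Y \<ge> ACE_true P Y)"
proof -
  note P = assms(1) and A_meas = assms(2) and A_range = assms(3) and Y_int = assms(4)
    and Z = assms(5) and e_reg = assms(6) and ps_def = assms(7) and ps_bounds = assms(8)
    and \<nu>_reg = assms(9) and \<nu>_int = assms(10) and g_ex = assms(11) and cov = assms(12)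
  interpret prob_space P by (rule P)
  define S where "S = arm P A 1"
  define p where "p = prob S"
  let ?I = "indicator S :: 'w \<Rightarrow> real"
  note [measurable] = A_meas
  have arm_sets [measurable]: "arm P A a \<in> sets P" for a
    unfolding arm_def by measurable
  then have [measurable]: "S \<in> sets P" by (simp add: S_def)
  have arm0: "arm P A 0 = space P - S"
    using A_range by (fastforce simp: arm_def S_def)
  have I0: "indicator (arm P A 0) w = 1 - ?I w" if "w \<in> space P" for w
    using that by (simp add: arm0 indicator_def)
  have I_mult: "integrable P (\<lambda>w. ?I w * f w)" "integrable P (\<lambda>w. f w * ?I w)"
    if "integrable P f" for f :: "'w \<Rightarrow> real"
    using integrable_mult_indicator[of S P f] that by (simp_all add: mult.commute)

  have e_meas: "e \<in> borel_measurable N"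
    using e_reg by (simp add: regression_version_def)
  then have ps_meas [measurable]: "ps \<in> borel_measurable P"
    unfolding ps_def using Z by measurable
  have ps_int: "integrable P ps"
    by (rule integrable_const_bound[where B = 1], use ps_bounds in eventually_elim) auto
  \<comment> \<open>A function of \<open>ps\<close> is also a function of Z, so the regression of
    the treatment on Z may be tested against the composition of \<phi> with
    \<open>e\<close>.\<close>
  have balance: "integrable P (\<lambda>w. \<phi> (ps w) * ps w)"
    "(\<integral>w. \<phi> (ps w) * ps w \<partial>P) = (\<integral>w. \<phi> (ps w) * ?I w \<partial>P)"
    if "\<phi> \<in> borel_measurable borel" "integrable P (\<lambda>w. \<phi> (ps w))" for \<phi>
    using regression_version_integral[OF P Z e_reg, where \<phi> = "\<lambda>z. \<phi> (e z)"] I_mult[OF that(2)]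
      that(1) e_meas
    by (simp_all add: ps_def S_def)
  have p_eq: "(\<integral>w. ps w \<partial>P) = p"
    using balance(2)[of "\<lambda>_. 1", OF borel_measurable_const integrable_const] by (simp add: p_def)
  \<comment> \<open>An almost sure strict inequality stays strict after integration over a
    probability space. Hence both arms have positive probability, and conditioning on either one is
    elementary.\<close>
  have p_pos: "0 < p"
    using integral_less_AE_space[of "\<lambda>_. 0" ps] ps_bounds ps_int
    by (auto simp: p_eq emeasure_space_1)
  have p_less: "p < 1"
    using integral_less_AE_space[of ps "\<lambda>_. 1"] ps_bounds ps_int
    by (auto simp: p_eq emeasure_space_1 prob_space)
  have prob_arm: "prob (arm P A 1) = p" "prob (arm P A 0) = 1 - p"
    by (simp_all add: p_def S_def arm0 prob_compl)
  have prob_arm_pos: "0 < prob (arm P A a)" if "a \<in> {0, 1}" for a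
    using that p_pos p_less prob_arm by auto

  have arm_prob_space: "prob_space (given_arm P A a)" if "a \<in> {0, 1}" for a
    unfolding given_arm_def using prob_arm_pos[OF that]
    by (intro prob_space_uniform_measure) (auto simp: emeasure_eq_measure)
  have arm_meas: "measurable (given_arm P A a) M' = measurable P M'" for a and M' :: "'c measure"
    by (intro measurable_cong_sets) (auto simp: given_arm_def)
  have arm_int: "integrable (given_arm P A a) f"
    if "a \<in> {0, 1}" "integrable P f" for f :: "'w \<Rightarrow> real" and a
    using integrable_uniform_measure_iff[OF P arm_sets prob_arm_pos[OF that(1)]] that(2)
      integrable_mult_indicator[OF arm_sets that(2)]
    by (simp add: given_arm_def borel_measurable_integrable)
  have arm_integral:
    "(\<integral>w. f w \<partial>given_arm P A 1) = (\<integral>w. f w * ?I w \<partial>P) / p"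
    "(\<integral>w. f w \<partial>given_arm P A 0) = ((\<integral>w. f w \<partial>P) - (\<integral>w. f w * ?I w \<partial>P)) / (1 - p)"
    if f: "integrable P f" for f
  proof -
    note eq = integral_uniform_measure_eq[OF P arm_sets prob_arm_pos
        borel_measurable_integrable[OF f]]
    show "(\<integral>w. f w \<partial>given_arm P A 1) = (\<integral>w. f w * ?I w \<partial>P) / p"
      using eq[of 1] prob_arm by (simp add: given_arm_def S_def mult.commute)
    have "(\<integral>w. indicator (arm P A 0) w * f w \<partial>P) = (\<integral>w. f w - f w * ?I w \<partial>P)"
      by (intro Bochner_Integration.integral_cong) (auto simp: I0 algebra_simps)
    then show "(\<integral>w. f w \<partial>given_arm P A 0)
        = ((\<integral>w. f w \<partial>P) - (\<integral>w. f w * ?I w \<partial>P)) / (1 - p)"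
      using eq[of 0] prob_arm I_mult[OF f] f by (simp add: given_arm_def)
  qed
  \<comment> \<open>Here E stands for an overall mean E(f) and J for the integral of f over the
    treated. By \<open>arm_integral\<close> the two arm means are J / p and (E - J) / (1 - p), and E
    is their mixture with weights p and 1 - p. One comparison of J with E p therefore places both
    arm means relative to E.\<close>
  have arm_mean_order:
    "E \<le> J / p" "(E - J) / (1 - p) \<le> E" if "E * p \<le> J" for E J
    using that p_pos p_less by (simp_all add: field_simps)
  have arm_mean_order':
    "J / p \<le> E" "E \<le> (E - J) / (1 - p)" if "J \<le> E * p" for E J
    using that p_pos p_less by (simp_all add: field_simps)

  let ?E = "\<lambda>f. \<integral>w. f w \<partial>P" and ?E\<^sub>A = "\<lambda>a f. \<integral>w. f w \<partial>given_arm P A a"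

  have Y_order: "?E (Y a) \<le> ?E\<^sub>A 1 (Y a)" "?E\<^sub>A 0 (Y a) \<le> ?E (Y a)" if a: "a \<in> {0, 1}" for a
  proof -
    obtain g where "mono g" "regression_version P ?I (Y a) borel g"
      using g_ex[OF a] by (auto simp: S_def)
    then have "?E (Y a) * ?E ?I \<le> (\<integral>w. Y a w * ?I w \<partial>P)"
      by (intro mono_regression_imp_nonneg_corr[OF P Y_int[OF a]])
        (auto intro: I_mult Y_int[OF a] simp: emeasure_eq_measure)
    then have "?E (Y a) * p \<le> (\<integral>w. Y a w * ?I w \<partial>P)"
      by (simp add: p_def)
    then show "?E (Y a) \<le> ?E\<^sub>A 1 (Y a)" "?E\<^sub>A 0 (Y a) \<le> ?E (Y a)"
      using arm_mean_order by (simp_all only: arm_integral[OF Y_int[OF a]])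
  qed

  have \<nu>_order: "?E\<^sub>A 1 (\<lambda>w. \<nu> a (ps w)) \<le> ?E (\<lambda>w. \<nu> a (ps w))"
    "?E (\<lambda>w. \<nu> a (ps w)) \<le> ?E\<^sub>A 0 (\<lambda>w. \<nu> a (ps w))" if a: "a \<in> {0, 1}" for a
  proof -
    have \<nu>_meas: "\<nu> a \<in> borel_measurable borel"
      using \<nu>_reg[OF a] by (simp add: regression_version_def)
    note b = balance[OF \<nu>_meas \<nu>_int[OF a]]
    \<comment> \<open>Balance with \<phi> = \<open>\<nu> a\<close> turns the product moment in the
      covariance into an integral over the treated. It also supplies integrability of the product;
      otherwise the integral in \<open>covar\<close> could be 0 merely by convention and the sign
      hypothesis would say nothing.\<close>
    have "(\<integral>w. \<nu> a (ps w) * ?I w \<partial>P) \<le> ?E (\<lambda>w. \<nu> a (ps w)) * p"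
      using cov[OF a] covar_eq[OF P ps_int \<nu>_int[OF a]] b by (simp add: p_eq mult.commute)
    then show "?E\<^sub>A 1 (\<lambda>w. \<nu> a (ps w)) \<le> ?E (\<lambda>w. \<nu> a (ps w))"
      "?E (\<lambda>w. \<nu> a (ps w)) \<le> ?E\<^sub>A 0 (\<lambda>w. \<nu> a (ps w))"
      using arm_mean_order' by (simp_all only: arm_integral[OF \<nu>_int[OF a]])
  qed

  have obs_int: "integrable P (observed A Y)"
  proof -
    \<comment> \<open>This is the observed outcome split over the treated and their complement, each
      piece being integrable.\<close>
    have "integrable P (\<lambda>w. Y 1 w * ?I w + (Y 0 w - Y 0 w * ?I w))"
      using Y_int I_mult by auto
    also have "?this \<longleftrightarrow> integrable P (observed A Y)"
      by (intro Bochner_Integration.integrable_cong)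
        (use A_range in \<open>force simp: observed_def S_def arm_def indicator_def\<close>)+
    finally show ?thesis .
  qed
  have obs_Y: "?E\<^sub>A a (observed A Y) = ?E\<^sub>A a (Y a)" if a: "a \<in> {0, 1}" for a
  proof -
    have "(\<integral>w. indicator (arm P A a) w * observed A Y w \<partial>P) = (\<integral>w. indicator (arm P A a) w * Y a w \<partial>P)"
      by (intro Bochner_Integration.integral_cong)
        (use a in \<open>auto simp: observed_def arm_def indicator_def\<close>)
    then show ?thesis
      using integral_uniform_measure_eq[OF P arm_sets prob_arm_pos[OF a]
          borel_measurable_integrable] obs_int Y_int[OF a]
      by (simp add: given_arm_def)
  qed
  \<comment> \<open>The tower property inside arm a: the regression is taken under
    \<open>given_arm P A a\<close>, and the test function is 1.\<close>
  have obs_\<nu>: "?E\<^sub>A a (\<lambda>w. \<nu> a (ps w)) = ?E\<^sub>A a (observed A Y)" if a: "a \<in> {0, 1}" for a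
    using regression_version_integral(2)[OF arm_prob_space[OF a] _ \<nu>_reg[OF a],
        where \<phi> = "\<lambda>_. 1"] arm_int[OF a obs_int]
    by (simp add: arm_meas borel_measurable_integrable[OF obs_int])

  have \<nu>_distr: "(\<integral>x. \<nu> a x \<partial>distr M borel ps) = (\<integral>w. \<nu> a (ps w) \<partial>M)"
    if "a \<in> {0, 1}" "ps \<in> borel_measurable M" for a and M :: "'w measure"
    using that \<nu>_reg[OF that(1)] by (intro integral_distr) (auto simp: regression_version_def)
  have adj: "ACE1_adj P A Y ps \<nu> = ?E\<^sub>A 1 (observed A Y) - ?E\<^sub>A 1 (\<lambda>w. \<nu> 0 (ps w))"
    "ACE0_adj P A Y ps \<nu> = ?E\<^sub>A 0 (\<lambda>w. \<nu> 1 (ps w)) - ?E\<^sub>A 0 (observed A Y)"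
    "ACE_adj P ps \<nu> = ?E (\<lambda>w. \<nu> 1 (ps w)) - ?E (\<lambda>w. \<nu> 0 (ps w))"
    by (simp_all add: ACE1_adj_def ACE0_adj_def ACE_adj_def \<nu>_distr arm_meas)
  have eqs: "?E\<^sub>A 1 (\<lambda>w. \<nu> 1 (ps w)) = ?E\<^sub>A 1 (observed A Y)"
    "?E\<^sub>A 0 (\<lambda>w. \<nu> 0 (ps w)) = ?E\<^sub>A 0 (observed A Y)"
    "?E\<^sub>A 1 (observed A Y) = ?E\<^sub>A 1 (Y 1)" "?E\<^sub>A 0 (observed A Y) = ?E\<^sub>A 0 (Y 0)"
    using obs_\<nu> obs_Y by auto
  \<comment> \<open>For the adjusted estimators, the chain from the treated through the overall to
    the control mean of \<open>\<nu> 0\<close> ends at E(Y | A = 0), and the one for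
    \<open>\<nu> 1\<close> starts at E(Y | A = 1). For the true effects, the chains for
    \<open>Y 1\<close> and \<open>Y 0\<close> run in the opposite direction. All six inequalities
    are linear consequences.\<close>
  show ?thesis
    unfolding adj ACE_unadj_def ACE_true_def ACE_true_arm_def
    using eqs Y_order[of 0] Y_order[of 1] \<nu>_order[of 0] \<nu>_order[of 1] by auto
qed

end
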